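(* Let $E$ be a bounded subset of a Euclidean space $\mathbb{R}^d$, let $n$ be a positive integer, and suppose that all data sets are supported on $E$. Then $$\Delta_0^{\mathrm{\check{C}ech}} := \sup_{H(D,D')\le 1} d_B\big(\mathcal{P}_0^{\mathrm{\check{C}ech}}(D), \mathcal{P}_0^{\mathrm{\check{C}ech}}(D')\big) \;\ge\; \frac{\operatorname{diam} E}{4}.$$ Moreover, the utility function $v_D(\mathcal{P}) := -d_B\big(\mathcal{P}_0^{\mathrm{\check{C}ech}}(D), \mathcal{P}\big)$ satisfies $$\frac{1}{4}\operatorname{diam} E \;\le\; \sup_{H(D,D')\le 1}\ \sup_{\mathcal{P}} \big|v_D(\mathcal{P}) - v_{D'}(\mathcal{P})\big| \;\le\; \operatorname{diam} E .$$ Here the suprema over $D,D'$ are over data sets of size $n$ in $E$, and $\mathcal{P}$ ranges over all persistence diagrams.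
   Context: Data sets of size $n$ in $E$ are $n$-tuples $D\in E^n$ (repeated points allowed). $H(D,D')$ is the Hamming distance: the number of entries in which $D$ and $D'$ differ. $\operatorname{diam}E$ is the Euclidean diameter. Čech persistence diagrams: for a finite set of points $D$ and $r\ge 0$, the Čech complex $\check{\mathcal C}(D;r)$ is the simplicial complex whose simplices are the nonempty finite subsets $\sigma\subseteq D$ such that the balls $B(x;r)$ of radius $r$ centered at the points $x\in\sigma$ have a common point in $\mathbb{R}^d$. These complexes form a filtration indexed by $r$, and $\mathcal{P}_0^{\mathrm{\check{C}ech}}(D)$ is the $0$th persistence diagram of this filtration, a multiset of birth-death pairs $(b,d)$ with $0\le b\le d\le\infty$. Bottleneck distance: for persistence diagrams $\mathcal P,\mathcal P'$ (finite multisets of points $(b,d)$, $0\le b\le d\le\infty$), $d_B(\mathcal P,\mathcal P')=\min_g\max_{z}\|z-g(z)\|_\infty$, where $g$ ranges over bijections between $\mathcal P$ and $\mathcal P'$, each augmented with copies of all points of the diagonal $\{(t,t)\}$, $z$ ranges over the augmented $\mathcal P$, and $|\infty-\infty|=0$.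
   Formalization: Both lower bounds diam E/4 are stated for n ≥ 2 only: for n = 1 every data set has diagram {(0,∞)}, so both suprema are 0 and the bounds fail as soon as E has two points. The upper bound is stated for every positive n. *)

theory Defs
  imports "HOL-Analysis.Analysis" "HOL-Library.Z2" "HOL-Library.Function_Algebras"
    "HOL-Library.Multiset"
begin

section \<open>Simplicial homology with coefficients in the two-element field\<close>

text \<open>
  A simplicial complex is given by its set of nonempty finite simplices.  The sum in
  \<open>boundary\<close> runs over the simplices of \<open>c\<close> having \<open>t\<close> as a facet; the empty face is
  discarded, so that the homology is unreduced.
\<close>

definition chains :: "nat \<Rightarrow> 'a set set \<Rightarrow> ('a set \<Rightarrow> bit) set" where
  "chains k K = {c. finite {s. c s \<noteq> 0} \<and> (\<forall>s. c s \<noteq> 0 \<longrightarrow> s \<in> K \<and> card s = Suc k)}"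

definition boundary :: "('a set \<Rightarrow> bit) \<Rightarrow> ('a set \<Rightarrow> bit)" where
  "boundary c = (\<lambda>t. if t = {} then 0
     else (\<Sum>s | c s \<noteq> 0 \<and> (\<exists>v. v \<notin> t \<and> s = insert v t). c s))"

definition cycles :: "nat \<Rightarrow> 'a set set \<Rightarrow> ('a set \<Rightarrow> bit) set" where
  "cycles k K = {c \<in> chains k K. boundary c = 0}"

definition boundaries :: "nat \<Rightarrow> 'a set set \<Rightarrow> ('a set \<Rightarrow> bit) set" where
  "boundaries k K = boundary ` chains (Suc k) K"

definition chain_dim :: "('a set \<Rightarrow> bit) set \<Rightarrow> nat" where
  "chain_dim = vector_space.dim (\<lambda>a c s. a * c s)"


section \<open>Persistence diagram of a filtration\<close>

text \<open>
  For \<open>K r \<subseteq> K s\<close> the rank of the map from the \<open>k\<close>-th homology of \<open>K r\<close> to that of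
  \<open>K s\<close> induced by the inclusion: the image is the quotient of the cycles of \<open>K r\<close> by
  those cycles of \<open>K r\<close> that bound in \<open>K s\<close>.
\<close>

definition pers_betti :: "nat \<Rightarrow> (real \<Rightarrow> 'a set set) \<Rightarrow> real \<Rightarrow> real \<Rightarrow> nat" where
  "pers_betti k K r s =
     chain_dim (cycles k (K r)) - chain_dim (cycles k (K r) \<inter> boundaries k (K s))"

text \<open>
  The multiplicity of \<open>(b, d)\<close> with \<open>b < d\<close> is the number of classes born at \<open>b\<close> and
  dying at \<open>d\<close>, given by the usual inclusion-exclusion over persistent Betti numbers just
  before and just after \<open>b\<close> and \<open>d\<close>.  The filtration is indexed by all reals; one that
  starts at \<open>0\<close> is empty at negative parameters.
\<close>

definition finite_pair_mult :: "nat \<Rightarrow> (real \<Rightarrow> 'a set set) \<Rightarrow> real \<Rightarrow> real \<Rightarrow> nat" where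
  "finite_pair_mult k K b d = (THE m. \<forall>\<^sub>F e in at_right 0. int m =
     (int (pers_betti k K (b + e) (d - e)) - int (pers_betti k K (b - e) (d - e))) -
     (int (pers_betti k K (b + e) (d + e)) - int (pers_betti k K (b - e) (d + e))))"

definition essential_mult :: "nat \<Rightarrow> (real \<Rightarrow> 'a set set) \<Rightarrow> real \<Rightarrow> nat" where
  "essential_mult k K b = (THE m. \<forall>\<^sub>F e in at_right 0. \<forall>\<^sub>F s in at_top. int m =
     int (pers_betti k K (b + e) s) - int (pers_betti k K (b - e) s))"

definition pair_mult :: "nat \<Rightarrow> (real \<Rightarrow> 'a set set) \<Rightarrow> ereal \<times> ereal \<Rightarrow> nat" where
  "pair_mult k K z = (case z of
       (ereal b, ereal d) \<Rightarrow> (if b < d then finite_pair_mult k K b d else 0)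
     | (ereal b, PInfty) \<Rightarrow> essential_mult k K b
     | _ \<Rightarrow> 0)"

text \<open>
  Pairs with \<open>b = d\<close> are not recorded.  \<open>pair_mult\<close> has finite support for filtrations of
  a finite complex with finitely many critical values, such as the one below.
\<close>

definition pers_diagram :: "nat \<Rightarrow> (real \<Rightarrow> 'a set set) \<Rightarrow> (ereal \<times> ereal) multiset" where
  "pers_diagram k K = Abs_multiset (pair_mult k K)"

text \<open>The complex is empty for \<open>r < 0\<close>, since then \<open>cball x r = {}\<close>.\<close>

definition cech_complex :: "'a::euclidean_space set \<Rightarrow> real \<Rightarrow> 'a set set" where
  "cech_complex D r = {s. s \<noteq> {} \<and> finite s \<and> s \<subseteq> D \<and> (\<Inter>x\<in>s. cball x r) \<noteq> {}}"

definition cech_diagram0 :: "'a::euclidean_space list \<Rightarrow> (ereal \<times> ereal) multiset" where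
  "cech_diagram0 D = pers_diagram 0 (cech_complex (set D))"


section \<open>Bottleneck distance\<close>

definition diagrams :: "(ereal \<times> ereal) multiset set" where
  "diagrams = {P. \<forall>(b, d) \<in> set_mset P. 0 \<le> b \<and> b \<le> d}"

text \<open>
  The convention that the difference of equal infinite values is \<open>0\<close>; on \<^typ>\<open>ereal\<close>
  itself \<open>\<infinity> - \<infinity> = \<infinity>\<close>.
\<close>

definition ext_abs_diff :: "ereal \<Rightarrow> ereal \<Rightarrow> ennreal" where
  "ext_abs_diff x y = (if x = y then 0 else e2ennreal \<bar>x - y\<bar>)"

definition linf_dist :: "ereal \<times> ereal \<Rightarrow> ereal \<times> ereal \<Rightarrow> ennreal" where
  "linf_dist z w = max (ext_abs_diff (fst z) (fst w)) (ext_abs_diff (snd z) (snd w))"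

text \<open>
  The augmented diagram as a set of indexed points: \<open>count P z\<close> copies of each point \<open>z\<close>
  off the diagonal, and countably many copies of each diagonal point.
\<close>

definition augmented :: "(ereal \<times> ereal) multiset \<Rightarrow> ((ereal \<times> ereal) \<times> nat) set" where
  "augmented P = {(z, i). (0 \<le> fst z \<and> fst z = snd z) \<or> i < count P z}"

definition bottleneck :: "(ereal \<times> ereal) multiset \<Rightarrow> (ereal \<times> ereal) multiset \<Rightarrow> ennreal" where
  "bottleneck P Q = (INF g \<in> {g. bij_betw g (augmented P) (augmented Q)}.
     SUP z \<in> augmented P. linf_dist (fst z) (fst (g z)))"


section \<open>Data sets, sensitivity and utility\<close>

definition data_sets :: "'a set \<Rightarrow> nat \<Rightarrow> 'a list set" where
  "data_sets E n = {D. length D = n \<and> set D \<subseteq> E}"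

definition hamming :: "'a list \<Rightarrow> 'a list \<Rightarrow> nat" where
  "hamming D D' = card {i. i < length D \<and> D ! i \<noteq> D' ! i}"

definition neighbours :: "'a set \<Rightarrow> nat \<Rightarrow> ('a list \<times> 'a list) set" where
  "neighbours E n = {(D, D'). D \<in> data_sets E n \<and> D' \<in> data_sets E n \<and> hamming D D' \<le> 1}"

definition cech_sensitivity0 :: "'a::euclidean_space set \<Rightarrow> nat \<Rightarrow> ennreal" where
  "cech_sensitivity0 E n =
     (SUP (D, D') \<in> neighbours E n. bottleneck (cech_diagram0 D) (cech_diagram0 D'))"

definition utility :: "'a::euclidean_space list \<Rightarrow> (ereal \<times> ereal) multiset \<Rightarrow> ereal" where
  "utility D P = - enn2ereal (bottleneck (cech_diagram0 D) P)"

definition utility_sensitivity :: "'a::euclidean_space set \<Rightarrow> nat \<Rightarrow> ennreal" where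
  "utility_sensitivity E n =
     (SUP (D, D') \<in> neighbours E n. SUP P \<in> diagrams. ext_abs_diff (utility D P) (utility D' P))"

end

theory Submission
  imports Defs
begin

text \<open>
  All vertices of a Cech filtration are born at \<open>0\<close>, so its zeroth diagram consists of one
  essential point \<open>(0, \<infinity>)\<close> and of points \<open>(0, dist x y / 2)\<close> with \<open>x, y\<close> in the data set.
  Retracting the latter to the diagonal costs at most half the diameter, so any two such diagrams
  are within distance \<open>diameter E\<close>, and the upper bound is the triangle inequality for the
  bottleneck distance.  For the lower bounds compare a data set concentrated at \<open>p\<close>, with diagram
  \<open>{(0, \<infinity>)}\<close>, with the one in which one entry is replaced by \<open>q\<close>: its additional point
  \<open>(0, dist p q / 2)\<close> can only be matched to the diagonal, at cost at least \<open>dist p q / 4\<close>.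
\<close>


section \<open>Zeroth homology of graphs\<close>

text \<open>The default rules turn the ring operations of \<^typ>\<open>bit\<close> into Boolean connectives, on which the
  ring lemmas no longer fire.\<close>

declare mult_bit_eq_and [simp del] add_bit_eq_xor [simp del]

interpretation chain: vector_space "\<lambda>(a::bit) (c::'a set \<Rightarrow> bit) s. a * c s"
  by unfold_locales (simp_all add: fun_eq_iff distrib_left distrib_right mult.assoc)

section \<open>Dimension counts in finite vector spaces\<close>

text \<open>A basis of \<open>W\<close> spans \<open>V\<close> as well. Finiteness of
  \<open>W\<close> excludes an infinite basis, whose \<open>card\<close> would be 0; the chain
  spaces over \<open>bit\<close> on finitely many vertices are finite as sets.\<close>

lemma (in vector_space) dim_mono_finite:
  assumes "V \<subseteq> W" "finite W"
  shows "dim V \<le> dim W"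
proof -
  obtain B where B: "B \<subseteq> W" "independent B" "W \<subseteq> span B" "card B = dim W"
    using basis_exists by blast
  then show ?thesis
    using assms dim_le_card[of V B] finite_subset[of B W] by auto
qed

lemma (in vector_space) card_independent_le_dim_finite:
  assumes "A \<subseteq> W" "finite W" "independent A"
  shows "card A \<le> dim W"
  using dim_mono_finite[OF assms(1,2)] dim_eq_card_independent[OF assms(3)] by simp

lemma chain_dim_eq: "chain_dim = chain.dim"
  by (simp add: chain_dim_def)

lemma finite_chains:
  assumes "finite D"
  shows "finite (chains k (Pow D))"
proof -
  have "chains k (Pow D) \<subseteq> {f. \<forall>s. (s \<in> Pow D \<longrightarrow> f s \<in> {0, 1}) \<and> (s \<notin> Pow D \<longrightarrow> f s = 0)}"
  proof
    fix c :: "'a set \<Rightarrow> bit" assume "c \<in> chains k (Pow D)"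
    then have "\<And>s. s \<notin> Pow D \<Longrightarrow> c s = 0"
      unfolding chains_def by blast
    moreover have "c s \<in> {0, 1}" for s
      by (cases "c s") simp_all
    ultimately show "c \<in> {f. \<forall>s. (s \<in> Pow D \<longrightarrow> f s \<in> {0, 1}) \<and> (s \<notin> Pow D \<longrightarrow> f s = 0)}"
      by (intro CollectI allI conjI impI)
  qed
  then show ?thesis
    by (rule finite_subset) (use assms in \<open>intro finite_set_of_finite_funs, simp_all\<close>)
qed

section \<open>Vertices and the augmentation map\<close>

definition vertex :: "'a \<Rightarrow> 'a set \<Rightarrow> bit" where
  "vertex x = (\<lambda>s. if s = {x} then 1 else 0)"

lemma vertex_in_chains: "x \<in> D \<Longrightarrow> vertex x \<in> chains 0 (Pow D)"
  by (auto simp: chains_def vertex_def)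

text \<open>The augmentation of the simplicial chain complex; it serves to separate a vertex from
  the 0-boundaries.\<close>

definition augmentation :: "'a set \<Rightarrow> ('a set \<Rightarrow> bit) \<Rightarrow> bit" where
  "augmentation D c = (\<Sum>x\<in>D. c {x})"

lemma subspace_augmentation: "chain.subspace {c. augmentation D c = 0}"
  by (simp add: chain.subspace_def augmentation_def sum.distrib) (simp add: sum_distrib_left[symmetric])

lemma augmentation_vertex:
  assumes "finite D" "x \<in> D"
  shows "augmentation D (vertex x) = 1"
  using assms by (simp add: augmentation_def vertex_def)

text \<open>Exchanging the sums counts every edge once for each of its two endpoints, and 2 = 0 in
  \<open>bit\<close>.\<close>

lemma augmentation_boundary:
  assumes "finite D" "G \<subseteq> Pow D" "c \<in> chains 1 G"
  shows "augmentation D (boundary c) = 0"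
proof -
  let ?S = "{s. c s \<noteq> 0}"
  have fin: "finite ?S" and S: "\<And>s. s \<in> ?S \<Longrightarrow> s \<subseteq> D \<and> card s = 2"
    using assms unfolding chains_def by (blast, auto)
  \<comment> \<open>For a two-element \<open>s\<close>, the condition under the sum in
    \<open>boundary\<close> at \<open>{x}\<close> just says that \<open>x\<close> is an endpoint of
    \<open>s\<close>.\<close>
  have face: "(\<exists>v. v \<notin> {x} \<and> s = insert v {x}) \<longleftrightarrow> x \<in> s" if "s \<in> ?S" for s x
  proof -
    from S[OF that] obtain a b where "s = {a, b}" "a \<noteq> b"
      unfolding card_2_iff by blast
    then show ?thesis by (auto simp: doubleton_eq_iff)
  qed
  have "{s. c s \<noteq> 0 \<and> (\<exists>v. v \<notin> {x} \<and> s = insert v {x})} = {s. s \<in> ?S \<and> x \<in> s}" for x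
    using face by blast
  then have "boundary c {x} = (\<Sum>s | s \<in> ?S \<and> x \<in> s. c s)" for x
    unfolding boundary_def by simp
  then have "augmentation D (boundary c) = (\<Sum>x\<in>D. \<Sum>s | s \<in> ?S \<and> x \<in> s. c s)"
    by (simp add: augmentation_def)
  also have "\<dots> = (\<Sum>s\<in>?S. \<Sum>x | x \<in> D \<and> x \<in> s. c s)"
    by (rule sum.swap_restrict[OF assms(1) fin])
  also have "\<dots> = (\<Sum>s\<in>?S. of_nat (card s) * c s)"
  proof (rule sum.cong[OF refl])
    fix s assume "s \<in> ?S"
    then have "{x. x \<in> D \<and> x \<in> s} = s" using S by auto
    then show "(\<Sum>x | x \<in> D \<and> x \<in> s. c s) = of_nat (card s) * c s" by simp
  qed
  also have "\<dots> = 0"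
  proof (rule sum.neutral, rule ballI)
    fix s assume "s \<in> ?S"
    then have "card s = 2" using S by blast
    then show "of_nat (card s) * c s = 0" by simp
  qed
  finally show ?thesis .
qed

text \<open>The number of connected components of the graph with vertices \<open>D\<close> whose edges are the
  two-element members of \<open>G\<close>.\<close>

definition graph_betti :: "'a set \<Rightarrow> 'a set set \<Rightarrow> nat" where
  "graph_betti D G =
     chain_dim (chains 0 (Pow D)) - chain_dim (chains 0 (Pow D) \<inter> boundaries 0 G)"

section \<open>Estimates for the number of components\<close>

lemma graph_betti_antimono:
  assumes "finite D" "G \<subseteq> H"
  shows "graph_betti D H \<le> graph_betti D G"
proof -
  have "boundaries 0 G \<subseteq> boundaries 0 H"
    using assms(2) by (auto simp: boundaries_def chains_def)
  then have "chain.dim (chains 0 (Pow D) \<inter> boundaries 0 G)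
      \<le> chain.dim (chains 0 (Pow D) \<inter> boundaries 0 H)"
    using assms(1) by (intro chain.dim_mono_finite) (auto simp: finite_chains)
  then show ?thesis
    by (simp add: graph_betti_def chain_dim_eq)
qed

text \<open>Boundaries have augmentation 0 and a vertex has augmentation 1, so a vertex enlarges a
  basis of the boundaries to a bigger independent set of 0-chains.\<close>

lemma graph_betti_pos:
  assumes "finite D" "x \<in> D" "G \<subseteq> Pow D"
  shows "1 \<le> graph_betti D G"
proof -
  define V where "V = chains 0 (Pow D)"
  define W where "W = V \<inter> boundaries 0 G"
  have fin: "finite V" unfolding V_def by (rule finite_chains[OF assms(1)])
  obtain B where B: "B \<subseteq> W" "chain.independent B" "W \<subseteq> chain.span B" "card B = chain.dim W"
    using chain.basis_exists by blast
  have "B \<subseteq> {c. augmentation D c = 0}"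
    using B(1) augmentation_boundary[OF assms(1,3)] by (auto simp: W_def boundaries_def)
  then have "chain.span B \<subseteq> {c. augmentation D c = 0}"
    by (rule chain.span_minimal[OF _ subspace_augmentation])
  then have notin: "vertex x \<notin> chain.span B"
    using augmentation_vertex[OF assms(1,2)] by auto
  have "insert (vertex x) B \<subseteq> V"
    using B(1) vertex_in_chains[OF assms(2)] by (auto simp: W_def V_def)
  moreover have "chain.independent (insert (vertex x) B)"
    using notin B(2) by (rule chain.independent_insertI)
  ultimately have "card (insert (vertex x) B) \<le> chain.dim V"
    using fin by (intro chain.card_independent_le_dim_finite)
  moreover have "finite B" using B(1) fin finite_subset by (auto simp: W_def)
  moreover have "vertex x \<notin> B" using notin chain.span_base by blast
  ultimately have "Suc (chain.dim W) \<le> chain.dim V"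
    using B(4) by simp
  then show ?thesis
    by (simp add: graph_betti_def chain_dim_eq V_def W_def)
qed

text \<open>A star of edges at \<open>p\<close> connects all vertices: the boundaries together with
  \<open>vertex p\<close> span the 0-chains, so the quotient has dimension at most 1, and
  \<open>graph_betti_pos\<close> gives at least 1.\<close>

lemma graph_betti_complete:
  assumes "finite D" "p \<in> D" "G \<subseteq> Pow D" "\<And>x. x \<in> D \<Longrightarrow> x \<noteq> p \<Longrightarrow> {p, x} \<in> G"
  shows "graph_betti D G = 1"
proof -
  define V where "V = chains 0 (Pow D)"
  define W where "W = V \<inter> boundaries 0 G"
  have fin: "finite V" unfolding V_def by (rule finite_chains[OF assms(1)])
  obtain B where B: "B \<subseteq> W" "chain.independent B" "W \<subseteq> chain.span B" "card B = chain.dim W"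
    using chain.basis_exists by blast
  \<comment> \<open>Coning a 0-chain off at \<open>p\<close> shows that it equals a boundary plus a multiple of \<open>p\<close>.\<close>
  have "V \<subseteq> chain.span (insert (vertex p) B)"
  proof
    fix c assume c: "c \<in> V"
    \<comment> \<open>The cone over \<open>c\<close>: the edge from \<open>p\<close> to
      \<open>x\<close> carries the coefficient of \<open>x\<close>, since \<open>s - {p}\<close> is
      then \<open>{x}\<close>.\<close>
    define e where "e = (\<lambda>s. if \<exists>x\<in>D. x \<noteq> p \<and> s = {p, x} then c (s - {p}) else 0)"
    have e: "e \<in> chains 1 G"
    proof -
      have "{s. e s \<noteq> 0} \<subseteq> Pow D"
        using assms(2) by (auto simp: e_def split: if_splits)
      then have "finite {s. e s \<noteq> 0}"
        using assms(1) finite_subset by blast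
      then show ?thesis
        using assms(4) by (auto simp: chains_def e_def card_2_iff split: if_splits)
    qed
    define b where "b = boundary e"
    \<comment> \<open>The only edge of \<open>e\<close> that contains a vertex \<open>x\<close>
      other than \<open>p\<close> is \<open>{p, x}\<close>.\<close>
    have b_x: "b {x} = c {x}" if "x \<noteq> p" for x
    proof (cases "c {x} = 0")
      case True
      have "e s = 0" if "v \<notin> {x}" "s = insert v {x}" for s v
        using that True \<open>x \<noteq> p\<close> by (auto simp: e_def doubleton_eq_iff insert_Diff_if)
      then have no: "{s. e s \<noteq> 0 \<and> (\<exists>v. v \<notin> {x} \<and> s = insert v {x})} = {}"
        by blast
      show ?thesis using True by (simp only: b_def boundary_def no) simp
    next
      case False
      then have "x \<in> D" using c by (auto simp: V_def chains_def)
      have "e {p, x} = c {x}"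
        using that \<open>x \<in> D\<close> by (auto simp: e_def insert_Diff_if)
      moreover have "e s = 0" if "v \<notin> {x}" "s = insert v {x}" "s \<noteq> {p, x}" for s v
        using that \<open>x \<noteq> p\<close> by (auto simp: e_def doubleton_eq_iff)
      ultimately have one: "{s. e s \<noteq> 0 \<and> (\<exists>v. v \<notin> {x} \<and> s = insert v {x})} = {{p, x}}"
        using False that by (intro subset_antisym subsetI) (blast, force)
      show ?thesis using \<open>e {p, x} = c {x}\<close> by (simp only: b_def boundary_def one) simp
    qed
    \<comment> \<open>This has to cover infinite \<open>t\<close> too, for which
      \<open>card t\<close> is 0; there \<open>insert v t\<close> is infinite and hence no edge of
      \<open>e\<close>.\<close>
    have b_card: "b t = 0" if "card t \<noteq> 1" for t
    proof (cases "t = {}")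
      case False
      have "e (insert v t) = 0" if "v \<notin> t" for v
      proof (rule ccontr)
        assume "e (insert v t) \<noteq> 0"
        then have "card (insert v t) = 2" using e by (auto simp: chains_def)
        moreover from this have "finite (insert v t)"
          by (intro card_ge_0_finite) simp
        ultimately show False using that \<open>card t \<noteq> 1\<close> by simp
      qed
      then have no: "{s. e s \<noteq> 0 \<and> (\<exists>v. v \<notin> t \<and> s = insert v t)} = {}"
        by blast
      show ?thesis by (simp only: b_def boundary_def no) simp
    qed (simp add: b_def boundary_def)
    have b_D: "s \<subseteq> D \<and> card s = 1" if "b s \<noteq> 0" for s
    proof -
      have "card s = 1" using b_card that by blast
      then obtain x where "s = {x}" by (rule card_1_singletonE)
      moreover have "x \<in> D" if "x \<noteq> p"
        using that b_x[OF that] \<open>b s \<noteq> 0\<close> \<open>s = {x}\<close> c by (auto simp: V_def chains_def)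
      ultimately show ?thesis using assms(2) by auto
    qed
    have "finite {s. b s \<noteq> 0}"
      by (rule finite_subset[of _ "Pow D"]) (use b_D assms(1) in auto)
    then have "b \<in> V" using b_D by (auto simp: V_def chains_def)
    then have "b \<in> W" using e by (auto simp: W_def b_def boundaries_def)
    then have "b \<in> chain.span (insert (vertex p) B)"
      using B(3) chain.span_mono[of B "insert (vertex p) B"] by blast
    \<comment> \<open>\<open>b\<close> and \<open>c\<close> agree at every singleton except possibly
      \<open>{p}\<close>; this multiple of \<open>vertex p\<close> corrects the coefficient
      there.\<close>
    moreover have "(\<lambda>s. (c {p} - b {p}) * vertex p s) \<in> chain.span (insert (vertex p) B)"
      by (intro chain.span_scale chain.span_base) simp
    ultimately have "b + (\<lambda>s. (c {p} - b {p}) * vertex p s) \<in> chain.span (insert (vertex p) B)"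
      by (rule chain.span_add)
    moreover have "b + (\<lambda>s. (c {p} - b {p}) * vertex p s) = c"
    proof
      fix s
      show "(b + (\<lambda>s. (c {p} - b {p}) * vertex p s)) s = c s"
      proof (cases "card s = 1")
        case True
        then obtain x where "s = {x}" by (rule card_1_singletonE)
        then show ?thesis using b_x[of x]
          by (cases "x = p") (simp_all add: vertex_def)
      next
        case False
        then have "c s = 0" "s \<noteq> {p}" using c by (auto simp: V_def chains_def)
        then show ?thesis using b_card[OF False] by (simp add: vertex_def)
      qed
    qed
    ultimately show "c \<in> chain.span (insert (vertex p) B)" by simp
  qed
  moreover have "finite B" using B(1) fin finite_subset by (auto simp: W_def)
  ultimately have "chain.dim V \<le> card (insert (vertex p) B)"
    by (intro chain.dim_le_card) auto
  also have "\<dots> \<le> Suc (chain.dim W)"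
    using B(4) by (simp add: card_insert_if \<open>finite B\<close>)
  finally have "graph_betti D G \<le> 1"
    by (simp add: graph_betti_def chain_dim_eq V_def W_def)
  then show ?thesis
    using graph_betti_pos[OF assms(1-3)] by simp
qed

text \<open>Two distinct vertices are independent 0-chains, and without edges only 0 is a
  boundary.\<close>

lemma graph_betti_no_edges:
  assumes "finite D" "p \<in> D" "q \<in> D" "p \<noteq> q"
  shows "2 \<le> graph_betti D {}"
proof -
  have ne: "vertex p \<noteq> vertex q" "vertex q \<noteq> 0"
    using assms(4) by (auto simp: vertex_def fun_eq_iff)
  have "vertex p \<notin> chain.span {vertex q}"
  proof
    assume "vertex p \<in> chain.span {vertex q}"
    then obtain a where "vertex p = (\<lambda>s. a * vertex q s)"
      unfolding chain.span_singleton by blast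
    then have "vertex p {p} = a * vertex q {p}" by simp
    then show False using assms(4) by (simp add: vertex_def)
  qed
  then have "chain.independent {vertex p, vertex q}"
    using ne by (intro chain.independent_insertI) (simp_all add: chain.independent_empty)
  then have "card {vertex p, vertex q} \<le> chain.dim (chains 0 (Pow D))"
    using assms by (intro chain.card_independent_le_dim_finite)
      (auto simp: vertex_in_chains finite_chains)
  moreover have "boundaries 0 ({} :: 'a set set) = {0}"
  proof -
    have "chains 1 ({} :: 'a set set) = {0}"
      by (auto simp: chains_def fun_eq_iff)
    moreover have "boundary (0 :: 'a set \<Rightarrow> bit) = 0"
      by (auto simp: boundary_def fun_eq_iff)
    ultimately show ?thesis by (simp add: boundaries_def)
  qed
  moreover have "chain.dim (chains 0 (Pow D) \<inter> {0}) \<le> card ({} :: ('a set \<Rightarrow> bit) set)"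
    by (intro chain.dim_le_card) auto
  ultimately show ?thesis
    using ne by (simp add: graph_betti_def chain_dim_eq)
qed


section \<open>Zeroth persistence diagrams of Cech filtrations\<close>

text \<open>Taking a set of admissible distances instead of a threshold treats the closed condition
  \<open>{..2 * s}\<close> and the strict one \<open>{..<2 * d}\<close>, which describes the graph
  just before \<open>d\<close>, alike.\<close>

definition edges :: "'a::metric_space set \<Rightarrow> real set \<Rightarrow> 'a set set" where
  "edges D R = {{x, y} | x y. x \<in> D \<and> y \<in> D \<and> x \<noteq> y \<and> dist x y \<in> R}"

lemma edges_subset_Pow: "edges D R \<subseteq> Pow D"
  by (auto simp: edges_def)

lemma edges_mono: "R \<subseteq> R' \<Longrightarrow> edges D R \<subseteq> edges D R'"
  unfolding edges_def by blast

lemma edges_cong: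
  assumes "\<forall>x\<in>D. \<forall>y\<in>D. dist x y \<in> R \<longleftrightarrow> dist x y \<in> R'"
  shows "edges D R = edges D R'"
  using assms unfolding edges_def by blast

lemma graph_betti_edges_complete:
  assumes "finite D" "D \<noteq> {}" "\<And>x y. x \<in> D \<Longrightarrow> y \<in> D \<Longrightarrow> dist x y \<in> R"
  shows "graph_betti D (edges D R) = 1"
proof -
  obtain p where "p \<in> D" using assms(2) by blast
  show ?thesis
  proof (rule graph_betti_complete[OF assms(1) \<open>p \<in> D\<close> edges_subset_Pow])
    show "{p, x} \<in> edges D R" if "x \<in> D" "x \<noteq> p" for x
      using that \<open>p \<in> D\<close> assms(3)[of p x] unfolding edges_def by blast
  qed
qed

section \<open>From Cech complexes to threshold graphs\<close>

text \<open>A common point of the two balls bounds the distance by the triangle inequality;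
  conversely the midpoint is a common point.\<close>

lemma pair_mem_cech_complex_iff:
  fixes x y :: "'a::euclidean_space"
  assumes "x \<in> D" "y \<in> D"
  shows "{x, y} \<in> cech_complex D s \<longleftrightarrow> dist x y \<le> 2 * s"
proof
  assume "{x, y} \<in> cech_complex D s"
  then obtain z where "dist x z \<le> s" "dist y z \<le> s"
    by (auto simp: cech_complex_def)
  then show "dist x y \<le> 2 * s"
    using dist_triangle2[of x y z] by linarith
next
  assume "dist x y \<le> 2 * s"
  then have "midpoint x y \<in> cball x s \<inter> cball y s"
    by (simp add: dist_midpoint)
  then have "(\<Inter>z\<in>{x, y}. cball z s) \<noteq> {}"
    by blast
  then show "{x, y} \<in> cech_complex D s"
    using assms by (simp add: cech_complex_def)
qed

text \<open>A 0-boundary comes from a 1-chain, and 1-chains see only the two-element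
  simplices.\<close>

lemma boundaries_cech_complex:
  fixes D :: "'a::euclidean_space set"
  shows "boundaries 0 (cech_complex D s) = boundaries 0 (edges D {..2 * s})"
proof -
  have *: "t \<in> cech_complex D s \<longleftrightarrow> t \<in> edges D {..2 * s}" if card_t: "card t = Suc 1" for t
  proof -
    from card_t obtain x y where t: "t = {x, y}" "x \<noteq> y"
      by (auto simp: card_2_iff numeral_2_eq_2[symmetric])
    show ?thesis
    proof (cases "x \<in> D \<and> y \<in> D")
      case True
      have "t \<in> edges D {..2 * s} \<longleftrightarrow> dist x y \<le> 2 * s"
        using t True by (auto simp: edges_def doubleton_eq_iff dist_commute)
      then show ?thesis
        using pair_mem_cech_complex_iff[of x D y s] True t by simp
    next
      case False
      then show ?thesis
        using t edges_subset_Pow[of D "{..2 * s}"] by (auto simp: cech_complex_def)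
    qed
  qed
  have "chains 1 (cech_complex D s) = chains 1 (edges D {..2 * s})"
    unfolding chains_def using * by blast
  then show ?thesis
    by (simp add: boundaries_def)
qed

text \<open>The only facet of a singleton is the empty set, which \<open>boundary\<close>
  discards.\<close>

lemma cycles_0: "cycles 0 K = chains 0 K"
proof -
  have "boundary c = 0" if c: "c \<in> chains 0 K" for c :: "'a set \<Rightarrow> bit"
  proof
    fix t
    show "boundary c t = 0 t"
    proof (cases "t = {}")
      case False
      have "c (insert v t) = 0" if "v \<notin> t" for v
      proof (rule ccontr)
        assume "c (insert v t) \<noteq> 0"
        then have "card (insert v t) = 1" using c by (simp add: chains_def)
        then show False using that False by (auto simp: card_1_singleton_iff)
      qed
      then have no: "{s. c s \<noteq> 0 \<and> (\<exists>v. v \<notin> t \<and> s = insert v t)} = {}"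
        by blast
      show ?thesis by (simp only: boundary_def no) simp
    qed (simp add: boundary_def)
  qed
  then show ?thesis by (auto simp: cycles_def)
qed

text \<open>All vertices are present from parameter 0 on, so the rank depends on \<open>s\<close>
  alone.\<close>

lemma pers_betti_cech:
  fixes D :: "'a::euclidean_space set"
  assumes "0 \<le> r"
  shows "pers_betti 0 (cech_complex D) r s = graph_betti D (edges D {..2 * s})"
proof -
  have "t \<in> cech_complex D r \<longleftrightarrow> t \<in> Pow D" if card_t: "card t = Suc 0" for t
  proof -
    from card_t obtain x where "t = {x}" by (auto simp: card_1_singleton_iff)
    moreover have "x \<in> cball x r" using assms by simp
    ultimately show ?thesis by (auto simp: cech_complex_def)
  qed
  then have "chains 0 (cech_complex D r) = chains 0 (Pow D)"
    unfolding chains_def by blast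
  then show ?thesis
    by (simp add: pers_betti_def graph_betti_def cycles_0 boundaries_cech_complex)
qed

lemma pers_betti_cech_neg:
  fixes D :: "'a::euclidean_space set"
  assumes "r < 0"
  shows "pers_betti 0 (cech_complex D) r s = 0"
proof -
  have "cech_complex D r = {}"
    using assms by (auto simp: cech_complex_def)
  then have "chains 0 (cech_complex D r) = {0}"
    by (auto simp: chains_def fun_eq_iff)
  moreover have "chain.dim {0 :: 'a set \<Rightarrow> bit} \<le> card ({} :: ('a set \<Rightarrow> bit) set)"
    by (intro chain.dim_le_card) auto
  ultimately show ?thesis
    by (simp add: pers_betti_def cycles_0 chain_dim_eq)
qed

section \<open>Multiplicities of the points of the diagram\<close>

text \<open>Evaluates the \<open>THE\<close> in the definitions of the multiplicities: along a
  nontrivial filter two eventual constants must coincide.\<close>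

lemma THE_eventually_eq:
  assumes "F \<noteq> bot" "\<forall>\<^sub>F e in F. int m = f e"
  shows "(THE m. \<forall>\<^sub>F e in F. int m = f e) = m"
proof (rule the_equality)
  fix k assume "\<forall>\<^sub>F e in F. int k = f e"
  with assms(2) have "\<forall>\<^sub>F e in F. k = m"
    by eventually_elim simp
  then show "k = m" using assms(1) by simp
qed (rule assms(2))

lemma eventually_at_right_0_less:
  "0 < (a::real) \<Longrightarrow> \<forall>\<^sub>F e in at_right 0. 0 < e \<and> e < a"
  using eventually_at_right_real[of 0 a] by simp

text \<open>The terms with negative birth parameter vanish, and inclusion-exclusion leaves the
  components lost at scale \<open>d\<close>. As \<open>D\<close> has finitely many distances, the
  graphs at \<open>d - e\<close> and \<open>d + e\<close> are constant for small
  \<open>e\<close>.\<close>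

lemma finite_pair_mult_cech_0:
  fixes D :: "'a::euclidean_space set"
  assumes "finite D" "0 < d"
  shows "finite_pair_mult 0 (cech_complex D) 0 d =
    graph_betti D (edges D {..<2 * d}) - graph_betti D (edges D {..2 * d})"
  unfolding finite_pair_mult_def
proof (rule THE_eventually_eq)
  \<comment> \<open>Approaching from the left turns the closed threshold into a strict one; for each
    pair of closer points it suffices that \<open>e\<close> is below the slack
    \<open>d - dist x y / 2\<close>.\<close>
  have "\<forall>\<^sub>F e in at_right 0. \<forall>x\<in>D. \<forall>y\<in>D. dist x y \<in> {..2 * (d - e)} \<longleftrightarrow> dist x y \<in> {..<2 * d}"
  proof (intro eventually_ball_finite assms(1) ballI)
    fix x y
    show "\<forall>\<^sub>F e in at_right 0. dist x y \<in> {..2 * (d - e)} \<longleftrightarrow> dist x y \<in> {..<2 * d}"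
    proof (cases "dist x y < 2 * d")
      case True
      then have "0 < d - dist x y / 2" by simp
      from eventually_at_right_0_less[OF this] show ?thesis
        by eventually_elim (use True in auto)
    next
      case False
      from eventually_at_right_0_less[OF zero_less_one] show ?thesis
        by eventually_elim (use False in auto)
    qed
  qed
  then have below: "\<forall>\<^sub>F e in at_right 0. edges D {..2 * (d - e)} = edges D {..<2 * d}"
    by eventually_elim (rule edges_cong)
  have "\<forall>\<^sub>F e in at_right 0. \<forall>x\<in>D. \<forall>y\<in>D. dist x y \<in> {..2 * (d + e)} \<longleftrightarrow> dist x y \<in> {..2 * d}"
  proof (intro eventually_ball_finite assms(1) ballI)
    fix x y
    show "\<forall>\<^sub>F e in at_right 0. dist x y \<in> {..2 * (d + e)} \<longleftrightarrow> dist x y \<in> {..2 * d}"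
    proof (cases "dist x y \<le> 2 * d")
      case False
      then have "0 < dist x y / 2 - d" by simp
      from eventually_at_right_0_less[OF this] show ?thesis
        by eventually_elim (use False in auto)
    next
      case True
      from eventually_at_right_0_less[OF zero_less_one] show ?thesis
        by eventually_elim (use True in auto)
    qed
  qed
  then have above: "\<forall>\<^sub>F e in at_right 0. edges D {..2 * (d + e)} = edges D {..2 * d}"
    by eventually_elim (rule edges_cong)
  \<comment> \<open>Makes the truncated subtraction on \<open>nat\<close> agree with the difference
    of integers.\<close>
  have le: "graph_betti D (edges D {..2 * d}) \<le> graph_betti D (edges D {..<2 * d})"
    using assms(1) by (intro graph_betti_antimono edges_mono) auto
  show "\<forall>\<^sub>F e in at_right 0.
      int (graph_betti D (edges D {..<2 * d}) - graph_betti D (edges D {..2 * d})) =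
      int (pers_betti 0 (cech_complex D) (0 + e) (d - e)) -
        int (pers_betti 0 (cech_complex D) (0 - e) (d - e)) -
      (int (pers_betti 0 (cech_complex D) (0 + e) (d + e)) -
        int (pers_betti 0 (cech_complex D) (0 - e) (d + e)))"
    using below above eventually_at_right_0_less[OF zero_less_one]
    by eventually_elim (simp add: le pers_betti_cech pers_betti_cech_neg of_nat_diff)
qed simp

text \<open>For \<open>e\<close> below the absolute value of \<open>b\<close>, the numbers
  \<open>b + e\<close> and \<open>b - e\<close> have the same sign, and on either side of 0 the
  birth parameter has no influence. Uniformity in \<open>s\<close> lets this serve finite and
  essential pairs.\<close>

lemma eventually_pers_betti_cech_eq:
  fixes D :: "'a::euclidean_space set"
  assumes "b \<noteq> 0"
  shows "\<forall>\<^sub>F e in at_right 0. \<forall>s.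
    pers_betti 0 (cech_complex D) (b + e) s = pers_betti 0 (cech_complex D) (b - e) s"
proof -
  have "0 < \<bar>b\<bar>" using assms by simp
  from eventually_at_right_0_less[OF this] show ?thesis
  proof eventually_elim
    case (elim e)
    show ?case
      using elim by (cases "0 < b") (simp_all add: pers_betti_cech pers_betti_cech_neg)
  qed
qed

lemma finite_pair_mult_cech_birth:
  fixes D :: "'a::euclidean_space set"
  assumes "b \<noteq> 0"
  shows "finite_pair_mult 0 (cech_complex D) b d = 0"
  unfolding finite_pair_mult_def
  by (rule THE_eventually_eq, simp)
    (use eventually_pers_betti_cech_eq[OF assms, of D] in \<open>eventually_elim, simp\<close>)

lemma THE_eventually_eventually_eq:
  assumes "F \<noteq> bot" "G \<noteq> bot" "\<forall>\<^sub>F e in F. \<forall>\<^sub>F s in G. int m = f e s"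
  shows "(THE m. \<forall>\<^sub>F e in F. \<forall>\<^sub>F s in G. int m = f e s) = m"
proof (rule the_equality)
  fix k assume "\<forall>\<^sub>F e in F. \<forall>\<^sub>F s in G. int k = f e s"
  with assms(3) have "\<forall>\<^sub>F e in F. k = m"
  proof eventually_elim
    case (elim e)
    then have "\<forall>\<^sub>F s in G. k = m" by eventually_elim simp
    then show ?case using assms(2) by simp
  qed
  then show "k = m" using assms(1) by simp
qed (rule assms(3))

lemma essential_mult_cech_birth:
  fixes D :: "'a::euclidean_space set"
  assumes "b \<noteq> 0"
  shows "essential_mult 0 (cech_complex D) b = 0"
  unfolding essential_mult_def
  by (rule THE_eventually_eventually_eq, simp, simp)
    (use eventually_pers_betti_cech_eq[OF assms, of D] in \<open>eventually_elim, simp\<close>)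

text \<open>For large \<open>s\<close> all points are joined and one component is left, while
  nothing exists at negative parameters.\<close>

lemma essential_mult_cech_0:
  fixes D :: "'a::euclidean_space set"
  assumes "finite D" "D \<noteq> {}"
  shows "essential_mult 0 (cech_complex D) 0 = 1"
  unfolding essential_mult_def
proof (rule THE_eventually_eventually_eq)
  have "\<forall>\<^sub>F s in at_top. \<forall>x\<in>D. \<forall>y\<in>D. dist x y \<le> 2 * s"
  proof (intro eventually_ball_finite assms(1) ballI)
    fix x y
    show "\<forall>\<^sub>F s in at_top. dist x y \<le> 2 * s"
      using eventually_ge_at_top[of "dist x y / 2"] by eventually_elim simp
  qed
  then have *: "\<forall>\<^sub>F s in at_top. graph_betti D (edges D {..2 * s}) = 1"
    by eventually_elim (rule graph_betti_edges_complete[OF assms], simp)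
  show "\<forall>\<^sub>F e in at_right 0. \<forall>\<^sub>F s in at_top.
      int 1 = int (pers_betti 0 (cech_complex D) (0 + e) s) -
        int (pers_betti 0 (cech_complex D) (0 - e) s)"
    using eventually_at_right_0_less[OF zero_less_one]
  proof eventually_elim
    case (elim e)
    show ?case using *
      by eventually_elim (use elim in \<open>simp add: pers_betti_cech pers_betti_cech_neg\<close>)
  qed
qed simp_all

lemma pair_mult_cech:
  fixes D :: "'a::euclidean_space set"
  assumes "finite D" "D \<noteq> {}"
  shows "pair_mult 0 (cech_complex D) (b, d) =
    (if b = 0 \<and> d = \<infinity> then 1
     else if b = 0 \<and> 0 < d then graph_betti D (edges D {..<2 * real_of_ereal d})
       - graph_betti D (edges D {..2 * real_of_ereal d})
     else 0)"
proof (cases b)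
  case (real b')
  then show ?thesis
    by (cases d; cases "b' = 0")
      (auto simp: pair_mult_def essential_mult_cech_0[OF assms] essential_mult_cech_birth
        finite_pair_mult_cech_0[OF assms(1)] finite_pair_mult_cech_birth zero_ereal_def)
qed (auto simp: pair_mult_def)

text \<open>If no two points have distance exactly \<open>2 * r\<close>, the strict and the closed
  threshold graphs coincide and nothing dies at \<open>r\<close>.\<close>

lemma pair_mult_cech_pos:
  fixes D :: "'a::euclidean_space set"
  assumes "finite D" "D \<noteq> {}" "0 < pair_mult 0 (cech_complex D) z"
  shows "z = (0, \<infinity>) \<or> (\<exists>x\<in>D. \<exists>y\<in>D. x \<noteq> y \<and> z = (0, ereal (dist x y / 2)))"
proof (rule ccontr)
  assume no: "\<not> ?thesis"
  obtain b d where z: "z = (b, d)" by fastforce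
  have "b = 0" "d \<noteq> \<infinity>" "0 < d"
    using assms(3) no unfolding z pair_mult_cech[OF assms(1,2)] by (auto split: if_splits)
  then obtain r where r: "d = ereal r" "0 < r" by (cases d) auto
  have "dist x y \<noteq> 2 * r" if "x \<in> D" "y \<in> D" for x y
  proof
    assume xy: "dist x y = 2 * r"
    then have "z = (0, ereal (dist x y / 2))" "x \<noteq> y"
      using r \<open>b = 0\<close> z by auto
    then show False using that no by blast
  qed
  then have "edges D {..<2 * r} = edges D {..2 * r}"
    by (intro edges_cong) (auto simp: order_le_less)
  then show False
    using assms(3) \<open>b = 0\<close> r unfolding z pair_mult_cech[OF assms(1,2)] by simp
qed

section \<open>The diagram as a multiset\<close>

text \<open>\<open>Abs_multiset\<close> can be inverted only at functions of finite support; here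
  the candidates are \<open>(0, \<infinity>)\<close> and one point for each pair of data
  points.\<close>

lemma count_cech_diagram0:
  assumes "D \<noteq> []"
  shows "count (cech_diagram0 D) = pair_mult 0 (cech_complex (set D))"
proof -
  have "{z. 0 < pair_mult 0 (cech_complex (set D)) z} \<subseteq>
    insert (0, \<infinity>) ((\<lambda>(x, y). (0, ereal (dist x y / 2))) ` (set D \<times> set D))"
  proof
    fix z assume "z \<in> {z. 0 < pair_mult 0 (cech_complex (set D)) z}"
    then have "z = (0, \<infinity>) \<or> (\<exists>x\<in>set D. \<exists>y\<in>set D. x \<noteq> y \<and> z = (0, ereal (dist x y / 2)))"
      using assms by (intro pair_mult_cech_pos) simp_all
    then show "z \<in> insert (0, \<infinity>) ((\<lambda>(x, y). (0, ereal (dist x y / 2))) ` (set D \<times> set D))"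
      by (elim disjE bexE conjE) (auto intro: rev_image_eqI[of "(_, _)"])
  qed
  then have "finite {z. 0 < pair_mult 0 (cech_complex (set D)) z}"
    by (rule finite_subset) simp
  then show ?thesis
    by (simp add: cech_diagram0_def pers_diagram_def Abs_multiset_inverse)
qed

lemma count_cech_diagram0_essential:
  "D \<noteq> [] \<Longrightarrow> count (cech_diagram0 D) (0, \<infinity>) = 1"
  by (simp add: count_cech_diagram0 pair_mult_cech)

lemma mem_cech_diagram0:
  assumes "D \<noteq> []" "z \<in># cech_diagram0 D"
  shows "z = (0, \<infinity>) \<or> (\<exists>x\<in>set D. \<exists>y\<in>set D. x \<noteq> y \<and> z = (0, ereal (dist x y / 2)))"
proof (rule pair_mult_cech_pos)
  show "0 < pair_mult 0 (cech_complex (set D)) z"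
    using assms by (simp add: count_cech_diagram0[symmetric])
qed (use assms in simp_all)

text \<open>Strictly below the distance there is no edge and there are two components; at the
  distance they merge, which happens at radius \<open>dist p q / 2\<close>.\<close>

lemma mem_cech_diagram0_pair:
  assumes "set D = {p, q}" "p \<noteq> q"
  shows "(0, ereal (dist p q / 2)) \<in># cech_diagram0 D"
proof -
  have "D \<noteq> []" using assms by auto
  have "edges {p, q} {..<dist p q} = {}"
    by (auto simp: edges_def dist_commute)
  moreover have "graph_betti {p, q} (edges {p, q} {..dist p q}) = 1"
    by (rule graph_betti_edges_complete) (auto simp: dist_commute)
  moreover have "2 \<le> graph_betti {p, q} {}"
    using assms(2) by (intro graph_betti_no_edges) auto
  ultimately have "0 < count (cech_diagram0 D) (0, ereal (dist p q / 2))"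
    using assms \<open>D \<noteq> []\<close> by (simp add: count_cech_diagram0 pair_mult_cech)
  then show ?thesis by simp
qed

lemma cech_diagram0_in_diagrams:
  assumes "D \<noteq> []"
  shows "cech_diagram0 D \<in> diagrams"
  using mem_cech_diagram0[OF assms] by (fastforce simp: diagrams_def)


section \<open>The bottleneck distance\<close>

lemma ext_abs_diff_self [simp]: "ext_abs_diff x x = 0"
  by (simp add: ext_abs_diff_def)

lemma ext_abs_diff_commute: "ext_abs_diff x y = ext_abs_diff y x"
  by (cases x; cases y) (auto simp: ext_abs_diff_def abs_minus_commute)

lemma ext_abs_diff_real: "ext_abs_diff (ereal x) (ereal y) = ennreal \<bar>x - y\<bar>"
  by (simp add: ext_abs_diff_def e2ennreal_ereal)

text \<open>If an infinite value occurs, then either \<open>x = z\<close> and the left side is 0, or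
  a summand on the right is infinite.\<close>

lemma ext_abs_diff_triangle: "ext_abs_diff x z \<le> ext_abs_diff x y + ext_abs_diff y z"
proof (cases "\<exists>a b c. x = ereal a \<and> y = ereal b \<and> z = ereal c")
  case True
  then obtain a b c where "x = ereal a" "y = ereal b" "z = ereal c" by blast
  moreover have "ennreal \<bar>a - c\<bar> \<le> ennreal \<bar>a - b\<bar> + ennreal \<bar>b - c\<bar>"
    by (simp flip: ennreal_plus)
  ultimately show ?thesis by (simp add: ext_abs_diff_real)
next
  case False
  then show ?thesis
    by (cases x; cases y; cases z) (auto simp: ext_abs_diff_def)
qed

lemma linf_dist_self [simp]: "linf_dist z z = 0"
  by (simp add: linf_dist_def)

lemma linf_dist_commute: "linf_dist z w = linf_dist w z"
  by (simp add: linf_dist_def ext_abs_diff_commute)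

lemma linf_dist_triangle: "linf_dist u w \<le> linf_dist u v + linf_dist v w"
  unfolding linf_dist_def
  by (intro max.boundedI order.trans[OF ext_abs_diff_triangle[of _ _ "fst v"]]
      order.trans[OF ext_abs_diff_triangle[of _ _ "snd v"]] add_mono) auto

lemma bottleneck_le:
  assumes "bij_betw g (augmented P) (augmented Q)"
    and "\<And>z. z \<in> augmented P \<Longrightarrow> linf_dist (fst z) (fst (g z)) \<le> c"
  shows "bottleneck P Q \<le> c"
  unfolding bottleneck_def using assms by (intro INF_lower2[of g] SUP_least) auto

lemma bottleneck_self [simp]: "bottleneck P P = 0"
proof -
  have "bottleneck P P \<le> 0"
    by (rule bottleneck_le[of id]) simp_all
  then show ?thesis by simp
qed

lemma bottleneck_commute: "bottleneck P Q = bottleneck Q P"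
proof -
  have "bottleneck Q P \<le> bottleneck P Q" for P Q
    unfolding bottleneck_def[of P Q]
  proof (rule INF_greatest)
    fix g assume "g \<in> {g. bij_betw g (augmented P) (augmented Q)}"
    then have g: "bij_betw g (augmented P) (augmented Q)" by simp
    show "bottleneck Q P \<le> (SUP z\<in>augmented P. linf_dist (fst z) (fst (g z)))"
    proof (rule bottleneck_le[OF bij_betw_inv_into[OF g]])
      fix w assume w: "w \<in> augmented Q"
      let ?z = "inv_into (augmented P) g w"
      have "?z \<in> augmented P" "g ?z = w"
        using w g by (auto simp: bij_betw_def inv_into_into f_inv_into_f)
      then show "linf_dist (fst w) (fst ?z) \<le> (SUP z\<in>augmented P. linf_dist (fst z) (fst (g z)))"
        using linf_dist_commute by (intro SUP_upper2[of ?z]) auto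
    qed
  qed
  then show ?thesis by (intro antisym)
qed

text \<open>A finite \<open>b\<close> can be moved to the other side. This permits passing to the
  infimum over one matching at a time.\<close>

lemma le_INF_add_ennreal:
  fixes x b :: ennreal
  assumes "\<And>i. i \<in> I \<Longrightarrow> x \<le> f i + b"
  shows "x \<le> (INF i\<in>I. f i) + b"
proof (cases "b = top")
  case False
  have "x - b \<le> (INF i\<in>I. f i)"
    using assms False by (intro INF_greatest) (simp add: ennreal_minus_le_iff add.commute)
  then show ?thesis
    using False by (simp add: ennreal_minus_le_iff add.commute)
qed simp

lemma bottleneck_triangle: "bottleneck P R \<le> bottleneck P Q + bottleneck Q R"
proof -
  have "bottleneck P R \<le> (SUP z\<in>augmented P. linf_dist (fst z) (fst (g z))) +
      (SUP z\<in>augmented Q. linf_dist (fst z) (fst (h z)))"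
    if g: "bij_betw g (augmented P) (augmented Q)" and h: "bij_betw h (augmented Q) (augmented R)"
    for g h
  proof (rule bottleneck_le[OF bij_betw_trans[OF g h]])
    fix z assume z: "z \<in> augmented P"
    then have "g z \<in> augmented Q" using g bij_betwE by blast
    then show "linf_dist (fst z) (fst ((h \<circ> g) z)) \<le>
      (SUP z\<in>augmented P. linf_dist (fst z) (fst (g z))) +
      (SUP z\<in>augmented Q. linf_dist (fst z) (fst (h z)))"
      using z by (intro order.trans[OF linf_dist_triangle[of _ _ "fst (g z)"]] add_mono)
        (auto intro: SUP_upper SUP_upper2)
  qed
  \<comment> \<open>The infimum over \<open>h\<close> is taken first, with \<open>g\<close> fixed;
    the one over \<open>g\<close> follows.\<close>
  then have *: "bottleneck P R \<le> bottleneck Q R + (SUP z\<in>augmented P. linf_dist (fst z) (fst (g z)))"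
    if "bij_betw g (augmented P) (augmented Q)" for g
    unfolding bottleneck_def[of Q R] using that
    by (intro le_INF_add_ennreal) (subst add.commute, blast)
  show ?thesis
    unfolding bottleneck_def[of P Q]
    by (intro le_INF_add_ennreal) (subst add.commute, use * in blast)
qed

section \<open>Matching with the diagram of a single point\<close>

text \<open>A bar \<open>(0, r)\<close> is at distance \<open>r / 2\<close> from its midpoint on the
  diagonal, and the essential points are matched at cost 0.\<close>

lemma bottleneck_collapse:
  assumes ess: "count P (0, \<infinity>) = 1"
    and P: "\<And>z. z \<in># P \<Longrightarrow> z = (0, \<infinity>) \<or> (\<exists>r. 0 < r \<and> r \<le> \<delta> \<and> z = (0, ereal r))"
  shows "bottleneck P {#(0, \<infinity>)#} \<le> ennreal (\<delta> / 2)"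
proof -
  let ?A = "augmented P" and ?B = "augmented {#(0, \<infinity>)#}"
  \<comment> \<open>The finite bars are sent to their midpoints on the diagonal; to make room, the copies of
    \<open>(t, t)\<close> are shifted by the number \<open>k t\<close> of bars with that midpoint.\<close>
  define k where "k t = (if t = \<infinity> then 0 else count P (0, 2 * t))" for t :: ereal
  define f where "f = (\<lambda>(z :: ereal \<times> ereal, i). if fst z = snd z then (z, i + k (fst z))
    else if snd z = \<infinity> then (z, i) else ((snd z / 2, snd z / 2), i))"
  \<comment> \<open>The inverse of \<open>f\<close>: the first \<open>k t\<close> copies of
    \<open>(t, t)\<close> come from bars, the later ones are shifted diagonal copies.\<close>
  define g where "g = (\<lambda>(z :: ereal \<times> ereal, i). if fst z \<noteq> snd z then (z, i)
    else if i < k (fst z) then ((0, 2 * fst z), i) else (z, i - k (fst z)))"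
  have A: "(\<exists>t. 0 \<le> t \<and> fst a = (t, t)) \<or> a = ((0, \<infinity>), 0) \<or>
      (\<exists>r i. 0 < r \<and> r \<le> \<delta> \<and> i < count P (0, ereal r) \<and> a = ((0, ereal r), i))"
    if "a \<in> ?A" for a
  proof -
    obtain z i where a: "a = (z, i)" by fastforce
    have "(0 \<le> fst z \<and> fst z = snd z) \<or> i < count P z"
      using that a by (simp add: augmented_def)
    then show ?thesis
    proof
      assume "0 \<le> fst z \<and> fst z = snd z"
      then show ?thesis using a by (cases z) auto
    next
      assume i: "i < count P z"
      then have "z \<in># P" by (simp flip: count_greater_zero_iff)
      from P[OF this] show ?thesis
        using i a ess by auto
    qed
  qed
  have B: "(\<exists>t. 0 \<le> t \<and> fst b = (t, t)) \<or> b = ((0, \<infinity>), 0)" if "b \<in> ?B" for b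
    using that by (cases b) (auto simp: augmented_def split: if_splits)
  have diag: "((t, t), i) \<in> augmented Q" if "0 \<le> t" for t i Q
    using that by (simp add: augmented_def)
  have essA: "((0, \<infinity>), 0) \<in> ?A" and essB: "((0, \<infinity>), 0) \<in> ?B"
    using ess by (simp_all add: augmented_def)
  have k_pos: "\<exists>r. 0 < r \<and> t = ereal (r / 2)" if "i < k t" for t i
  proof -
    have t: "t \<noteq> \<infinity>" and "(0, 2 * t) \<in># P"
      using that by (auto simp: k_def count_inI split: if_splits)
    from P[OF this(2)] show ?thesis
      using t by (cases t) auto
  qed
  have A_cases: "f a \<in> ?B \<and> g (f a) = a \<and> linf_dist (fst a) (fst (f a)) \<le> ennreal (\<delta> / 2)"
    if "a \<in> ?A" for a
    using A[OF that]
  proof (elim disjE exE conjE)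
    fix t assume "0 \<le> t" "fst a = (t, t)"
    then show ?thesis
      by (cases a) (auto simp: f_def g_def diag)
  next
    assume "a = ((0, \<infinity>), 0)"
    then show ?thesis by (simp add: f_def g_def essB)
  next
    fix r i assume r: "0 < r" "r \<le> \<delta>" "i < count P (0, ereal r)" and a: "a = ((0, ereal r), i)"
    have fa: "f a = ((ereal (r / 2), ereal (r / 2)), i)"
      using r a by (simp add: f_def zero_ereal_def)
    moreover have "k (ereal (r / 2)) = count P (0, ereal r)"
      by (simp add: k_def)
    moreover have "linf_dist (0, ereal r) (ereal (r / 2), ereal (r / 2)) \<le> ennreal (\<delta> / 2)"
      using r by (auto simp: linf_dist_def zero_ereal_def ext_abs_diff_real intro!: ennreal_leI)
    ultimately show ?thesis
      using r a by (auto simp: g_def diag)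
  qed
  have B_cases: "g b \<in> ?A \<and> f (g b) = b" if "b \<in> ?B" for b
    using B[OF that]
  proof (elim disjE exE conjE)
    fix t assume t: "0 \<le> t" "fst b = (t, t)"
    then obtain i where b: "b = ((t, t), i)" by (cases b) auto
    show ?thesis
    proof (cases "i < k t")
      case True
      from k_pos[OF True] obtain r where r: "0 < r" "t = ereal (r / 2)" by blast
      then have "g b = ((0, ereal r), i)"
        using True b by (simp add: g_def)
      moreover have "i < count P (0, ereal r)"
        using True r by (simp add: k_def)
      ultimately show ?thesis
        using r b by (simp add: f_def augmented_def zero_ereal_def)
    next
      case False
      then show ?thesis using b t by (simp add: f_def g_def diag)
    qed
  next
    assume "b = ((0, \<infinity>), 0)"
    then show ?thesis by (simp add: f_def g_def essA)
  qed
  have "bij_betw f ?A ?B"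
    by (rule bij_betw_byWitness[where f' = g]) (use A_cases B_cases in auto)
  then show ?thesis
    by (rule bottleneck_le) (use A_cases in blast)
qed

text \<open>The partner of \<open>(0, c)\<close> is either \<open>(0, \<infinity>)\<close>,
  infinitely far away, or some \<open>(t, t)\<close>; for finite \<open>t\<close> one of the
  distances from \<open>t\<close> to 0 and to \<open>c\<close> is at least
  \<open>c / 2\<close>.\<close>

lemma bottleneck_ge_half_persistence:
  assumes Q: "(0, ereal c) \<in># Q" and P: "\<And>z. z \<in># P \<Longrightarrow> z = (0, \<infinity>)"
  shows "ennreal (c / 2) \<le> bottleneck Q P"
  unfolding bottleneck_def
proof (rule INF_greatest)
  fix g assume "g \<in> {g. bij_betw g (augmented Q) (augmented P)}"
  then have g: "bij_betw g (augmented Q) (augmented P)" by simp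
  have z: "((0, ereal c), 0) \<in> augmented Q"
    using Q by (simp add: augmented_def)
  then have "g ((0, ereal c), 0) \<in> augmented P"
    using g bij_betwE by blast
  then obtain w i where w: "g ((0, ereal c), 0) = (w, i)" "(w, i) \<in> augmented P"
    by (metis surj_pair)
  have "ennreal (c / 2) \<le> linf_dist (0, ereal c) w"
  proof (cases "fst w = snd w")
    case True
    then obtain t where t: "w = (t, t)" by (cases w) auto
    show ?thesis
    proof (cases t)
      case (real r)
      have "c / 2 \<le> \<bar>r\<bar> \<or> c / 2 \<le> \<bar>c - r\<bar>" by linarith
      then show ?thesis
        unfolding t real
        by (auto simp: linf_dist_def zero_ereal_def ext_abs_diff_real le_max_iff_disj
            intro: ennreal_leI)
    qed (simp_all add: t linf_dist_def ext_abs_diff_def)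
  next
    case False
    then have "i < count P w" using w(2) by (simp add: augmented_def)
    then have "w \<in># P" by (simp flip: count_greater_zero_iff)
    then have "w = (0, \<infinity>)" by (rule P)
    then show ?thesis by (simp add: linf_dist_def ext_abs_diff_def)
  qed
  then show "ennreal (c / 2) \<le> (SUP z\<in>augmented Q. linf_dist (fst z) (fst (g z)))"
    using w z by (intro SUP_upper2[OF z]) simp
qed


section \<open>Sensitivity\<close>

text \<open>Both diagrams are compared with the one consisting of \<open>(0, \<infinity>)\<close>
  alone. Bars have length at most half the diameter; the cruder bound \<open>diameter E\<close> on
  their length already makes the two legs add up to \<open>diameter E\<close>.\<close>

lemma bottleneck_cech_le_diameter:
  fixes E :: "'a::euclidean_space set"
  assumes "bounded E" "D \<noteq> []" "set D \<subseteq> E" "D' \<noteq> []" "set D' \<subseteq> E"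
  shows "bottleneck (cech_diagram0 D) (cech_diagram0 D') \<le> ennreal (diameter E)"
proof -
  have *: "bottleneck (cech_diagram0 X) {#(0, \<infinity>)#} \<le> ennreal (diameter E / 2)"
    if X: "X \<noteq> []" "set X \<subseteq> E" for X
  proof (rule bottleneck_collapse[OF count_cech_diagram0_essential[OF X(1)]])
    fix z assume "z \<in># cech_diagram0 X"
    from mem_cech_diagram0[OF X(1) this]
    show "z = (0, \<infinity>) \<or> (\<exists>r>0. r \<le> diameter E \<and> z = (0, ereal r))"
    proof (elim disjE bexE conjE)
      fix x y assume xy: "x \<in> set X" "y \<in> set X" "x \<noteq> y" "z = (0, ereal (dist x y / 2))"
      then have "dist x y \<le> diameter E"
        using X(2) by (intro diameter_bounded_bound[OF assms(1)]) auto
      moreover have "0 < dist x y" using xy(3) by simp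
      ultimately show ?thesis
        using xy(4) by (intro disjI2 exI[of _ "dist x y / 2"] conjI) linarith+
    qed simp
  qed
  have "bottleneck (cech_diagram0 D) (cech_diagram0 D') \<le>
      ennreal (diameter E / 2) + ennreal (diameter E / 2)"
    using *[OF assms(2,3)] *[OF assms(4,5)]
    by (intro order.trans[OF bottleneck_triangle[of _ _ "{#(0, \<infinity>)#}"]] add_mono)
      (simp_all add: bottleneck_commute)
  also have "\<dots> = ennreal (diameter E)"
    using diameter_ge_0[OF assms(1)] by (simp flip: ennreal_plus)
  finally show ?thesis .
qed

text \<open>Stated additively because the distances may be infinite. For finite \<open>c\<close> the
  hypotheses make \<open>a\<close> and \<open>b\<close> both finite or both infinite, and in the
  latter case the difference is 0 by convention.\<close>

lemma ext_abs_diff_uminus_enn2ereal_le: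
  assumes "a \<le> c + b" "b \<le> c + a"
  shows "ext_abs_diff (- enn2ereal a) (- enn2ereal b) \<le> c"
proof (cases "c = top")
  case False
  then obtain c' where c: "c = ennreal c'" "0 \<le> c'" by (cases c) auto
  show ?thesis
  proof (cases a)
    case (real a')
    then have "b \<noteq> top" using assms(2) c by (auto simp: top_unique)
    then obtain b' where b: "b = ennreal b'" "0 \<le> b'" by (cases b) auto
    have "\<bar>- a' - - b'\<bar> \<le> c'"
      using assms real b c by (simp flip: ennreal_plus)
    then show ?thesis
      using real b c by (simp add: enn2ereal_ennreal ext_abs_diff_real ennreal_leI)
  next
    case top
    then have "b = top" using assms(1) c by (auto simp: top_unique)
    then show ?thesis using top by simp
  qed
qed simp

text \<open>The diameter is a supremum over pairs; pairs with \<open>p = q\<close> and an empty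
  \<open>E\<close> are covered by nonnegativity of \<open>s\<close>.\<close>

lemma diameter_le_ennreal:
  fixes E :: "'a::real_normed_vector set"
  assumes "\<And>p q. p \<in> E \<Longrightarrow> q \<in> E \<Longrightarrow> p \<noteq> q \<Longrightarrow> ennreal (dist p q / 4) \<le> s"
  shows "ennreal (diameter E / 4) \<le> s"
proof (cases s)
  case (real s')
  have "diameter E \<le> 4 * s'"
  proof (rule diameter_le)
    fix p q assume "p \<in> E" "q \<in> E"
    then show "norm (p - q) \<le> 4 * s'"
      using assms[of p q] real by (cases "p = q") (auto simp: dist_norm)
  qed (use real in simp)
  then show ?thesis using real by (simp add: ennreal_leI)
qed simp

text \<open>For \<open>n = 1\<close> every data set is a single point with diagram
  \<open>{#(0, \<infinity>)#}\<close>, so both sensitivities are 0 and the lower bounds fail as soon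
  as \<open>E\<close> has two points; hence the condition \<open>2 \<le> n\<close> there.\<close>

theorem theorem5:
  fixes E :: "'a::euclidean_space set" and n :: nat
  assumes "bounded E" and "0 < n"
  shows "(2 \<le> n \<longrightarrow> ennreal (diameter E / 4) \<le> cech_sensitivity0 E n) \<and>
         (2 \<le> n \<longrightarrow> ennreal (diameter E / 4) \<le> utility_sensitivity E n) \<and>
         utility_sensitivity E n \<le> ennreal (diameter E)"
proof -
  have witness: "\<exists>(D, D') \<in> neighbours E n.
      ennreal (dist p q / 4) \<le> bottleneck (cech_diagram0 D) (cech_diagram0 D') \<and> D' \<noteq> []"
    if n: "2 \<le> n" and pq: "p \<in> E" "q \<in> E" "p \<noteq> q" for p q
  proof -
    \<comment> \<open>As \<open>2 \<le> n\<close>, the common tail contains \<open>p\<close>, so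
      changing the head from \<open>p\<close> to \<open>q\<close> adds a second point without losing
      the first.\<close>
    define D where "D = q # replicate (n - 1) p"
    define D' where "D' = p # replicate (n - 1) p"
    have sets: "set D = {p, q}" "set D' = {p}"
      using n by (auto simp: D_def D'_def)
    have "{i. i < length D \<and> D ! i \<noteq> D' ! i} \<subseteq> {0}"
      by (auto simp: D_def D'_def nth_Cons')
    then have "hamming D D' \<le> 1"
      unfolding hamming_def using card_mono[of "{0::nat}"] by fastforce
    then have "(D, D') \<in> neighbours E n"
      using n pq sets by (auto simp: neighbours_def data_sets_def D_def D'_def)
    moreover have "ennreal (dist p q / 2 / 2) \<le> bottleneck (cech_diagram0 D) (cech_diagram0 D')"
    proof (rule bottleneck_ge_half_persistence)
      show "(0, ereal (dist p q / 2)) \<in># cech_diagram0 D"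
        by (rule mem_cech_diagram0_pair[OF sets(1) pq(3)])
      show "z = (0, \<infinity>)" if "z \<in># cech_diagram0 D'" for z
        using mem_cech_diagram0[of D' z] that sets by (auto simp: D'_def)
    qed
    ultimately show ?thesis
      by (intro bexI[of _ "(D, D')"]) (auto simp: D'_def)
  qed
  have "ennreal (diameter E / 4) \<le> cech_sensitivity0 E n" if "2 \<le> n"
  proof (rule diameter_le_ennreal)
    fix p q assume "p \<in> E" "q \<in> E" "p \<noteq> q"
    from witness[OF that this] show "ennreal (dist p q / 4) \<le> cech_sensitivity0 E n"
      unfolding cech_sensitivity0_def by (auto intro: SUP_upper2)
  qed
  moreover have "ennreal (diameter E / 4) \<le> utility_sensitivity E n" if "2 \<le> n"
  proof (rule diameter_le_ennreal)
    fix p q assume "p \<in> E" "q \<in> E" "p \<noteq> q"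
    from witness[OF that this] obtain D D' where D: "(D, D') \<in> neighbours E n" "D' \<noteq> []"
      "ennreal (dist p q / 4) \<le> bottleneck (cech_diagram0 D) (cech_diagram0 D')"
      by auto
    \<comment> \<open>At this diagram the utility of \<open>D'\<close> vanishes.\<close>
    let ?P = "cech_diagram0 D'"
    have "ext_abs_diff (utility D ?P) (utility D' ?P) = bottleneck (cech_diagram0 D) ?P"
      by (cases "bottleneck (cech_diagram0 D) ?P")
        (simp_all add: utility_def enn2ereal_ennreal zero_ennreal.rep_eq zero_ereal_def
          ext_abs_diff_real, simp add: ext_abs_diff_def)
    with D(3) have "ennreal (dist p q / 4) \<le>
        (SUP P \<in> diagrams. ext_abs_diff (utility D P) (utility D' P))"
      using cech_diagram0_in_diagrams[OF D(2)] by (intro SUP_upper2[of ?P]) auto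
    then show "ennreal (dist p q / 4) \<le> utility_sensitivity E n"
      unfolding utility_sensitivity_def using D(1) by (intro SUP_upper2[of "(D, D')"]) auto
  qed
  moreover have "utility_sensitivity E n \<le> ennreal (diameter E)"
    unfolding utility_sensitivity_def
  proof (intro SUP_least, clarify, intro SUP_least)
    fix D D' :: "'a list" and P assume "(D, D') \<in> neighbours E n"
    then have D: "D \<noteq> []" "set D \<subseteq> E" "D' \<noteq> []" "set D' \<subseteq> E"
      using assms(2) by (auto simp: neighbours_def data_sets_def)
    \<comment> \<open>The triangle inequality through the diagram of \<open>Y\<close>; it is used
      for both orders of the two data sets.\<close>
    have le: "bottleneck (cech_diagram0 X) P \<le> ennreal (diameter E) + bottleneck (cech_diagram0 Y) P"
      if "X \<noteq> []" "set X \<subseteq> E" "Y \<noteq> []" "set Y \<subseteq> E" for X Y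
      using bottleneck_cech_le_diameter[OF assms(1) that]
      by (intro order.trans[OF bottleneck_triangle[of _ P "cech_diagram0 Y"]] add_right_mono)
    show "ext_abs_diff (utility D P) (utility D' P) \<le> ennreal (diameter E)"
      unfolding utility_def using D by (intro ext_abs_diff_uminus_enn2ereal_le le)
  qed
  ultimately show ?thesis by blast
qed

end
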